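(* Let $k,t$ be integers with $1\leq k\leq t$ and let $d=\binom{2t-2k}{t-k}$. Then $$N((k,k;d),2t)=bc_{d}(I_{2t}(k,k))=bp_{d}(I_{2t}(k,k))=\binom{2t}{t}.$$
   Context: Let $d,n,t,r,w$ be positive integers and $B=\{B_1,\ldots,B_t\}$ a collection of subsets (blocks) of a set $X$ with $|X|=n$. The pair $(X,B)$ is an $(r,w;d)$-CFF$(n,t)$ (cover-free family) if for any $L,M\subseteq[t]$ with $L\cap M=\emptyset$, $|L|=r$, $|M|=w$, we have $|(\bigcap_{l\in L}B_l)\setminus(\bigcup_{m\in M}B_m)|\geq d$. $N((r,w;d),t)$ is the minimum $n$ for which an $(r,w;d)$-CFF$(n,t)$ exists. A biclique of a graph is a complete bipartite subgraph. The $d$-biclique covering number $bc_d(G)$ is the smallest number of bicliques of $G$ such that every edge of $G$ belongs to at least $d$ of them; the $d$-biclique partition number $bp_d(G)$ is the smallest number of bicliques of $G$ such that every edge of $G$ belongs to exactly $d$ of them. The bi-intersection graph $I_n(r,w)$ is the bipartite graph whose vertices are all $w$-subsets and all $r$-subsets of an $n$-element set (as the two sides), a $w$-subset adjacent to an $r$-subset iff they are disjoint. *)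

theory Defs
  imports
    "Graph_Theory.Kuratowski"
    "HOL-Library.Multiset"
    "HOL-Library.Extended_Nat"
begin

text \<open>
  The blocks are an indexed family, so \<open>B i = B j\<close> is allowed for \<open>i \<noteq> j\<close>.
\<close>

definition cover_free_family ::
  "nat \<Rightarrow> nat \<Rightarrow> nat \<Rightarrow> nat \<Rightarrow> nat \<Rightarrow> 'x set \<Rightarrow> (nat \<Rightarrow> 'x set) \<Rightarrow> bool" where
  "cover_free_family r w d n t X B \<longleftrightarrow>
     0 < n \<and> finite X \<and> card X = n \<and> (\<forall>i\<in>{1..t}. B i \<subseteq> X) \<and>
     (\<forall>L M. L \<subseteq> {1..t} \<and> M \<subseteq> {1..t} \<and> L \<inter> M = {} \<and> card L = r \<and> card M = w \<longrightarrow>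
        d \<le> card ((\<Inter>l\<in>L. B l) - (\<Union>m\<in>M. B m)))"

text \<open>
  The minima below are taken in \<^typ>\<open>enat\<close>: over the empty set they are \<open>\<infinity>\<close>, so
  a finite value entails that the minimum is attained.
  In the next definition, points are natural numbers without loss of generality,
  since \<open>X\<close> is finite.
\<close>

definition cff_number :: "nat \<Rightarrow> nat \<Rightarrow> nat \<Rightarrow> nat \<Rightarrow> enat" where
  "cff_number r w d t =
     Inf {enat n | n. \<exists>(X :: nat set) B. cover_free_family r w d n t X B}"

text \<open>
  As in the library, an undirected graph is a symmetric digraph, an edge being a pair of
  opposite arcs. The graph \<open>K\<^bsub>m,n\<^esub>\<close> is symmetric by definition, so an edge belongs to a
  biclique iff either one of its two arcs does.
\<close>

definition biclique :: "'v pair_pre_digraph \<Rightarrow> 'v pair_pre_digraph \<Rightarrow> bool" where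
  "biclique G H \<longleftrightarrow>
     subgraph (with_proj H) (with_proj G) \<and>
     (\<exists>m n. 0 < m \<and> 0 < n \<and> complete_bipartite_digraph m n (with_proj H))"

text \<open>
  Coverings and partitions are multisets: a biclique may be used repeatedly, each use
  counting towards the multiplicity \<open>d\<close> and towards the size.
\<close>

definition biclique_covering :: "nat \<Rightarrow> 'v pair_pre_digraph \<Rightarrow> 'v pair_pre_digraph multiset \<Rightarrow> bool" where
  "biclique_covering d G F \<longleftrightarrow>
     (\<forall>H\<in>#F. biclique G H) \<and> (\<forall>e\<in>parcs G. d \<le> size {#H \<in># F. e \<in> parcs H#})"

definition biclique_partition :: "nat \<Rightarrow> 'v pair_pre_digraph \<Rightarrow> 'v pair_pre_digraph multiset \<Rightarrow> bool" where
  "biclique_partition d G F \<longleftrightarrow>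
     (\<forall>H\<in>#F. biclique G H) \<and> (\<forall>e\<in>parcs G. size {#H \<in># F. e \<in> parcs H#} = d)"

definition biclique_covering_number :: "nat \<Rightarrow> 'v pair_pre_digraph \<Rightarrow> enat" where
  "biclique_covering_number d G = Inf {enat (size F) | F. biclique_covering d G F}"

definition biclique_partition_number :: "nat \<Rightarrow> 'v pair_pre_digraph \<Rightarrow> enat" where
  "biclique_partition_number d G = Inf {enat (size F) | F. biclique_partition d G F}"

text \<open>
  The two sides are tagged by \<^const>\<open>Inl\<close> (\<open>w\<close>-subsets) and \<^const>\<open>Inr\<close> (\<open>r\<close>-subsets):
  they must stay disjoint also when \<open>r = w\<close>.
\<close>

definition bi_intersection_graph :: "nat \<Rightarrow> nat \<Rightarrow> nat \<Rightarrow> (nat set + nat set) pair_pre_digraph" where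
  "bi_intersection_graph n r w =
     (let W = {S. S \<subseteq> {1..n} \<and> card S = w};
          R = {S. S \<subseteq> {1..n} \<and> card S = r};
          A = {(Inl S, Inr T) | S T. S \<in> W \<and> T \<in> R \<and> S \<inter> T = {}}
      in \<lparr>pverts = W <+> R, parcs = A \<union> A\<inverse>\<rparr>)"

lemma pair_graph_bi_intersection_graph: "pair_graph (bi_intersection_graph n r w)"
proof -
  let ?P = "Pow {1..n} <+> Pow {1..n}"
  have "pverts (bi_intersection_graph n r w) \<subseteq> ?P"
    and "parcs (bi_intersection_graph n r w) \<subseteq> ?P \<times> ?P"
    by (auto simp: bi_intersection_graph_def Let_def)
  then have "finite (pverts (bi_intersection_graph n r w))"
    and "finite (parcs (bi_intersection_graph n r w))"
    by (auto intro: finite_subset)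
  then show ?thesis
    by unfold_locales
      (auto simp: bi_intersection_graph_def Let_def symmetric_def sym_def arcs_ends_def arc_to_ends_def)
qed

end

theory Submission
  imports Defs
begin

text \<open>
  Double counting. Every point of a cover-free family, and every biclique, determines a subset
  \<open>A\<close> of \<open>[2t]\<close> such that it covers only pairs \<open>(L, M)\<close> with \<open>L \<subseteq> A\<close> and \<open>M \<inter> A = {}\<close>. There are
  \<open>C(a,k) C(2t - a,k)\<close> such pairs of \<open>k\<close>-sets for \<open>a = |A|\<close>, and this is largest for \<open>a = t\<close>.
  The family of all \<open>t\<close>-subsets covers every pair exactly \<open>d\<close> times and each of its members
  attains the maximum, so it is optimal for all three problems.
\<close>

section \<open>Pairs of disjoint \<open>k\<close>-sets and the sets that separate them\<close>

definition disjoint_pairs :: "nat \<Rightarrow> 'a set \<Rightarrow> ('a set \<times> 'a set) set" where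
  "disjoint_pairs k V =
     {(L, M). L \<subseteq> V \<and> M \<subseteq> V \<and> L \<inter> M = {} \<and> card L = k \<and> card M = k}"

definition separates :: "'a set \<Rightarrow> 'a set \<times> 'a set \<Rightarrow> bool" where
  "separates A e \<longleftrightarrow> fst e \<subseteq> A \<and> snd e \<inter> A = {}"

definition subsets_of_card :: "nat \<Rightarrow> 'a set \<Rightarrow> 'a set set" where
  "subsets_of_card t V = {T. T \<subseteq> V \<and> card T = t}"

lemma finite_disjoint_pairs: "finite V \<Longrightarrow> finite (disjoint_pairs k V)"
  by (rule finite_subset[of _ "Pow V \<times> Pow V"]) (auto simp: disjoint_pairs_def)

lemma finite_subsets_of_card: "finite V \<Longrightarrow> finite (subsets_of_card t V)"
  by (simp add: subsets_of_card_def)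

lemma card_subsets_of_card: "finite V \<Longrightarrow> card (subsets_of_card t V) = card V choose t"
  by (simp add: subsets_of_card_def n_subsets)

lemma card_separated_pairs:
  assumes "finite V" "A \<subseteq> V"
  shows "card {e \<in> disjoint_pairs k V. separates A e}
    = (card A choose k) * (card (V - A) choose k)"
proof -
  have "{e \<in> disjoint_pairs k V. separates A e}
      = {L. L \<subseteq> A \<and> card L = k} \<times> {M. M \<subseteq> V - A \<and> card M = k}"
    using assms by (auto simp: disjoint_pairs_def separates_def)
  then show ?thesis
    using assms by (simp add: card_cartesian_product n_subsets finite_subset)
qed

text \<open>Deleting \<open>L\<close> from \<open>T\<close> leaves an arbitrary subset of
  \<open>V - L - M\<close> with \<open>t - card L\<close> elements, and adding \<open>L\<close>
  undoes this. If \<open>card L\<close> exceeded \<open>t\<close>, truncated subtraction would make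
  the last binomial 1 although no such \<open>T\<close> exists.\<close>

lemma card_subsets_of_card_between:
  assumes "finite V" "L \<subseteq> V" "M \<subseteq> V" "L \<inter> M = {}" "card L \<le> t"
  shows "card {T \<in> subsets_of_card t V. separates T (L, M)}
    = (card V - card L - card M) choose (t - card L)"
proof -
  let ?W = "V - L - M"
  have fin: "finite L" "finite M" "finite ?W"
    using assms finite_subset by auto
  have "bij_betw (\<lambda>S. S \<union> L) {S. S \<subseteq> ?W \<and> card S = t - card L}
      {T \<in> subsets_of_card t V. separates T (L, M)}"
  proof (rule bij_betw_byWitness[where f' = "\<lambda>T. T - L"])
    show "(\<lambda>S. S \<union> L) ` {S. S \<subseteq> ?W \<and> card S = t - card L}
        \<subseteq> {T \<in> subsets_of_card t V. separates T (L, M)}"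
    proof (rule image_subsetI)
      fix S assume "S \<in> {S. S \<subseteq> ?W \<and> card S = t - card L}"
      then have S: "S \<subseteq> ?W" "card S = t - card L" by auto
      have "finite S" "S \<inter> L = {}"
        using S(1) fin(3) by (auto dest: finite_subset)
      then have "card (S \<union> L) = t"
        using S fin assms by (simp add: card_Un_disjoint)
      then show "S \<union> L \<in> {T \<in> subsets_of_card t V. separates T (L, M)}"
        using S assms by (auto simp: subsets_of_card_def separates_def)
    qed
    show "(\<lambda>T. T - L) ` {T \<in> subsets_of_card t V. separates T (L, M)}
        \<subseteq> {S. S \<subseteq> ?W \<and> card S = t - card L}"
      using fin by (auto simp: subsets_of_card_def separates_def card_Diff_subset)
  qed (auto simp: subsets_of_card_def separates_def)
  from bij_betw_same_card[OF this]
  have "card {T \<in> subsets_of_card t V. separates T (L, M)} = card ?W choose (t - card L)"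
    by (simp only: n_subsets[OF fin(3)])
  moreover have "card ?W = card V - card L - card M"
  proof -
    have "M \<subseteq> V - L" using assms by auto
    then show ?thesis using assms fin by (simp add: card_Diff_subset)
  qed
  ultimately show ?thesis by simp
qed

section \<open>Products of two binomials whose upper indices have a fixed sum\<close>

lemma binomial_mult_fact: "(n choose k) * fact k = (\<Prod>i<k. n - i)"
proof (induction k)
  case (Suc k)
  have "(n choose Suc k) * fact (Suc k) = (Suc k * (n choose Suc k)) * fact k"
    by (simp add: algebra_simps)
  \<comment> \<open>Both absorption laws have the right-hand side
    \<open>n * ((n - 1) choose k)\<close>, so their left-hand sides agree. For
    \<open>k \<ge> n\<close> both of these vanish, thanks to truncated subtraction.\<close>
  also have "\<dots> = (n - k) * ((n choose k) * fact k)"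
    using binomial_absorption[of k n] binomial_absorb_comp[of n k] by simp
  finally show ?case
    using Suc by simp
qed simp

text \<open>Multiplying by \<open>fact k * fact k\<close> turns both sides into products of
  \<open>k\<close> factors, which compare index by index: unless truncated, \<open>a - i\<close> and
  \<open>b - i\<close> have sum \<open>2 * (t - i)\<close>, so their product is at most the square
  of their mean \<open>t - i\<close>.\<close>

lemma binomial_mult_le_square:
  assumes "a + b = 2 * t" "k \<le> t"
  shows "(a choose k) * (b choose k) \<le> (t choose k) * (t choose k)"
proof -
  have "(a - i) * (b - i) \<le> (t - i) * (t - i)" if "i < k" for i
  \<comment> \<open>In the other case one of \<open>a - i\<close> and \<open>b - i\<close> is
    truncated to 0, and so is their product.\<close>
  proof (cases "i \<le> a \<and> i \<le> b")
    case True
    then obtain x y where xy: "a = i + x" "b = i + y"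
      by (meson le_Suc_ex)
    define z where "z = t - i"
    have "x + y = 2 * z" "t = i + z"
      using assms that xy by (auto simp: z_def)
    \<comment> \<open>This is the square of \<open>x - y\<close> being nonnegative, taken over the
      integers because subtraction of naturals truncates.\<close>
    moreover have "4 * (int x * int y) \<le> (int x + int y) * (int x + int y)"
      using zero_le_square[of "int x - int y"] by (simp add: algebra_simps)
    moreover have "int x + int y = 2 * int z"
      using \<open>x + y = 2 * z\<close> by linarith
    ultimately have "int x * int y \<le> int z * int z"
      by simp
    then have "x * y \<le> z * z"
      by (simp flip: of_nat_mult)
    then show ?thesis using xy \<open>t = i + z\<close> by simp
  qed auto
  then have "(\<Prod>i<k. (a - i) * (b - i)) \<le> (\<Prod>i<k. (t - i) * (t - i))"
    by (intro prod_mono) auto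
  then have "((a choose k) * (b choose k)) * (fact k * fact k)
      \<le> ((t choose k) * (t choose k)) * (fact k * fact k)"
    by (simp add: prod.distrib mult.commute mult.left_commute flip: binomial_mult_fact)
  then show ?thesis by simp
qed

section \<open>Double counting of incidences\<close>

lemma sum_size_filter_mset:
  assumes "finite E"
  shows "(\<Sum>e\<in>E. size {#x \<in># F. P x e#}) = (\<Sum>x\<in>#F. card {e \<in> E. P x e})"
\<comment> \<open>Induction over the multiset, since members of \<open>F\<close> count with
  multiplicity.\<close>
proof (induction F)
  case (add x F)
  have "(\<Sum>e\<in>E. size (filter_mset (\<lambda>x. P x e) (add_mset x F)))
      = (\<Sum>e\<in>E. (if P x e then 1 else 0) + size {#x \<in># F. P x e#})"
    by (rule sum.cong) auto
  also have "\<dots> = card {e \<in> E. P x e} + (\<Sum>x\<in>#F. card {e \<in> E. P x e})"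
    using assms add by (simp add: sum.distrib sum.If_cases Int_def)
  finally show ?case by simp
qed simp

text \<open>Incidences between pairs and separating \<open>t\<close>-subsets, counted from both
  sides. This is the equality case of the bound in \<open>binomial_le_size_covering\<close>, and it
  spares evaluating the number of pairs.\<close>

lemma card_disjoint_pairs:
  assumes "finite V" "card V = 2 * t" "k \<le> t"
  shows "card (disjoint_pairs k V) * ((2 * t - 2 * k) choose (t - k))
    = ((2 * t) choose t) * ((t choose k) * (t choose k))"
proof -
  let ?T = "subsets_of_card t V" and ?E = "disjoint_pairs k V"
  have fin: "finite ?T" "finite ?E"
    using assms by (simp_all add: finite_subsets_of_card finite_disjoint_pairs)
  have "card {T \<in> ?T. separates T e} = (2 * t - 2 * k) choose (t - k)" if "e \<in> ?E" for e
    using that assms card_subsets_of_card_between[of V "fst e" "snd e" t]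
    by (auto simp: disjoint_pairs_def mult_2)
  then have "card ?E * ((2 * t - 2 * k) choose (t - k))
      = (\<Sum>e\<in>?E. card {T \<in> ?T. separates T e})"
    by simp
  also have "\<dots> = (\<Sum>e\<in>?E. size {#T \<in># mset_set ?T. separates T e#})"
    using fin by simp
  also have "\<dots> = (\<Sum>T\<in>?T. card {e \<in> ?E. separates T e})"
    using fin by (simp only: sum_size_filter_mset) (simp add: sum_unfold_sum_mset)
  also have "\<dots> = (\<Sum>T\<in>?T. (t choose k) * (t choose k))"
    using assms
    by (intro sum.cong)
      (auto simp: card_separated_pairs subsets_of_card_def card_Diff_subset finite_subset)
  finally show ?thesis
    using assms by (simp add: card_subsets_of_card)
qed

text \<open>The lower bound common to all three problems: \<open>x\<close> is a point or a biclique,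
  and \<open>P x e\<close> means that it covers \<open>e\<close>. A single set \<open>A\<close>
  separates everything that \<open>x\<close> covers, so \<open>x\<close> covers at most as many
  pairs as a \<open>t\<close>-subset separates.\<close>

lemma binomial_le_size_covering:
  assumes "finite V" "card V = 2 * t" "k \<le> t"
    and "\<And>e. e \<in> disjoint_pairs k V \<Longrightarrow>
      (2 * t - 2 * k) choose (t - k) \<le> size {#x \<in># F. P x e#}"
    and "\<And>x. x \<in># F \<Longrightarrow> \<exists>A\<subseteq>V. \<forall>e\<in>disjoint_pairs k V. P x e \<longrightarrow> separates A e"
  shows "(2 * t) choose t \<le> size F"
proof -
  let ?E = "disjoint_pairs k V" and ?c = "(t choose k) * (t choose k)"
  have fin: "finite ?E"
    using assms(1) by (rule finite_disjoint_pairs)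
  have bound: "card {e \<in> ?E. P x e} \<le> ?c" if x: "x \<in># F" for x
  proof -
    obtain A where A: "A \<subseteq> V" "\<forall>e\<in>?E. P x e \<longrightarrow> separates A e"
      using assms(5)[OF x] by blast
    have "card {e \<in> ?E. P x e} \<le> card {e \<in> ?E. separates A e}"
      using A fin by (intro card_mono) auto
    also have "\<dots> = (card A choose k) * (card (V - A) choose k)"
      using assms A by (simp add: card_separated_pairs)
    also have "\<dots> \<le> ?c"
    proof (rule binomial_mult_le_square)
      show "card A + card (V - A) = 2 * t"
        using A assms by (metis card_Diff_subset card_mono finite_subset le_add_diff_inverse)
    qed fact
    finally show ?thesis .
  qed
  \<comment> \<open>The total demand, pairs times required multiplicity, equals what the
    \<open>t\<close>-subsets supply. Each member of \<open>F\<close> supplies at most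
    \<open>?c\<close>, which is positive by \<open>k \<le> t\<close> and cancels.\<close>
  have "((2 * t) choose t) * ?c = card ?E * ((2 * t - 2 * k) choose (t - k))"
    using assms by (simp add: card_disjoint_pairs)
  also have "\<dots> \<le> (\<Sum>e\<in>?E. size {#x \<in># F. P x e#})"
    using assms(4) sum_mono[of ?E "\<lambda>_. (2 * t - 2 * k) choose (t - k)"] by simp
  also have "\<dots> = (\<Sum>x\<in>#F. card {e \<in> ?E. P x e})"
    using fin by (rule sum_size_filter_mset)
  also have "\<dots> \<le> (\<Sum>x\<in>#F. ?c)"
    using bound by (rule sum_mset_mono)
  finally have "((2 * t) choose t) * ?c \<le> size F * ?c"
    by simp
  moreover have "?c > 0"
    using assms by simp
  ultimately show ?thesis by simp
qed

section \<open>Cover-free families\<close>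

lemma binomial_le_cover_free_family:
  assumes "cover_free_family k k ((2 * t - 2 * k) choose (t - k)) n (2 * t) X B" "1 \<le> k" "k \<le> t"
  shows "(2 * t) choose t \<le> n"
proof -
  define P where "P x e \<longleftrightarrow> x \<in> (\<Inter>l\<in>fst e. B l) - (\<Union>m\<in>snd e. B m)" for x e
  have X: "finite X" "card X = n" "\<And>i. i \<in> {1..2 * t} \<Longrightarrow> B i \<subseteq> X"
    using assms by (auto simp: cover_free_family_def)
  have "(2 * t) choose t \<le> size (mset_set X)"
  proof (rule binomial_le_size_covering[where V = "{1..2 * t}" and k = k and P = P])
    fix e assume e: "e \<in> disjoint_pairs k {1..2 * t}"
    \<comment> \<open>Since \<open>k\<close> is positive, the index set of the intersection is
      nonempty; over an empty one the intersection would be \<open>UNIV\<close> and escape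
      \<open>X\<close>.\<close>
    then have "fst e \<noteq> {}" "fst e \<subseteq> {1..2 * t}"
      using assms(2) by (auto simp: disjoint_pairs_def)
    then obtain l where "l \<in> fst e" "B l \<subseteq> X"
      using X(3) by blast
    then have "{x \<in> X. P x e} = (\<Inter>l\<in>fst e. B l) - (\<Union>m\<in>snd e. B m)"
      by (auto simp: P_def)
    then show "(2 * t - 2 * k) choose (t - k) \<le> size {#x \<in># mset_set X. P x e#}"
      using assms(1) e X(1) by (auto simp: cover_free_family_def disjoint_pairs_def)
  next
    fix x
    show "\<exists>A\<subseteq>{1..2 * t}. \<forall>e\<in>disjoint_pairs k {1..2 * t}. P x e \<longrightarrow> separates A e"
      \<comment> \<open>The set that belongs to a point \<open>x\<close> consists of the indices of
        the blocks containing \<open>x\<close>.\<close>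
      by (rule exI[of _ "{i \<in> {1..2 * t}. x \<in> B i}"])
        (auto simp: P_def separates_def disjoint_pairs_def)
  qed (use assms in auto)
  then show ?thesis using X by simp
qed

text \<open>The points are the \<open>t\<close>-subsets of \<open>{1..2 * t}\<close>, and block
  \<open>i\<close> consists of those containing \<open>i\<close>. A point lies in all blocks of
  \<open>L\<close> and in none of \<open>M\<close> iff its subset separates \<open>(L, M)\<close>.
  The bijection \<open>h\<close> renames the points as naturals.\<close>

lemma ex_cover_free_family:
  assumes "1 \<le> k" "k \<le> t"
  shows "\<exists>(X :: nat set) B. cover_free_family k k ((2 * t - 2 * k) choose (t - k))
    ((2 * t) choose t) (2 * t) X B"
proof -
  let ?V = "{1..2 * t}"
  let ?T = "subsets_of_card t ?V"
  obtain h where h: "bij_betw h {0..<(2 * t) choose t} ?T"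
    using ex_bij_betw_nat_finite[of ?T]
    by (auto simp: finite_subsets_of_card card_subsets_of_card)
  define X where "X = {0..<(2 * t) choose t}"
  define B where "B i = {j \<in> X. i \<in> h j}" for i
  have "(2 * t - 2 * k) choose (t - k) \<le> card ((\<Inter>l\<in>L. B l) - (\<Union>m\<in>M. B m))"
    if LM: "L \<subseteq> ?V" "M \<subseteq> ?V" "L \<inter> M = {}" "card L = k" "card M = k" for L M
  proof -
    have "L \<noteq> {}" using LM assms by auto
    then have eq: "(\<Inter>l\<in>L. B l) - (\<Union>m\<in>M. B m) = {j \<in> X. separates (h j) (L, M)}"
      by (auto simp: B_def separates_def)
    have "?T = h ` X"
      using h by (simp add: bij_betw_def X_def)
    then have "h ` {j \<in> X. separates (h j) (L, M)} = {T \<in> ?T. separates T (L, M)}"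
      by auto
    moreover have "card {T \<in> ?T. separates T (L, M)} = (2 * t - 2 * k) choose (t - k)"
      using card_subsets_of_card_between[of ?V L M t] LM assms by (simp add: mult_2)
    \<comment> \<open>The image under \<open>h\<close> has exactly the required size, and an image
      is never larger than the set mapped.\<close>
    ultimately show ?thesis
      unfolding eq using card_image_le[of "{j \<in> X. separates (h j) (L, M)}" h]
      by (simp add: X_def)
  qed
  then have "cover_free_family k k ((2 * t - 2 * k) choose (t - k)) ((2 * t) choose t) (2 * t) X B"
    by (auto simp: cover_free_family_def X_def B_def)
  then show ?thesis by blast
qed

section \<open>Bicliques of the bi-intersection graph\<close>

lemma parcs_bi_intersection_graph:
  "parcs (bi_intersection_graph n k k)
    = (\<lambda>(L, M). (Inl L, Inr M)) ` disjoint_pairs k {1..n}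
      \<union> (\<lambda>(L, M). (Inr M, Inl L)) ` disjoint_pairs k {1..n}"
  by (fastforce simp: bi_intersection_graph_def disjoint_pairs_def Let_def)

lemma arc_bi_intersection_graph:
  "(Inl L, Inr M) \<in> parcs (bi_intersection_graph n k k) \<longleftrightarrow> (L, M) \<in> disjoint_pairs k {1..n}"
  "(Inr M, Inl L) \<in> parcs (bi_intersection_graph n k k) \<longleftrightarrow> (L, M) \<in> disjoint_pairs k {1..n}"
  unfolding parcs_bi_intersection_graph by (auto simp: image_iff intro!: bexI[of _ "(L, M)"])

text \<open>Take for \<open>A\<close> the union of the \<open>Inl\<close> sets on edges of
  \<open>H\<close>. In a biclique each of them is adjacent to every \<open>Inr\<close> set
  \<open>M\<close> on an edge, hence disjoint from \<open>M\<close>; so \<open>A\<close> is disjoint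
  from \<open>M\<close> as well.\<close>

lemma biclique_separates:
  assumes "biclique (bi_intersection_graph n k k) H"
  shows "\<exists>A\<subseteq>{1..n}. \<forall>(L, M)\<in>disjoint_pairs k {1..n}.
    (Inl L, Inr M) \<in> parcs H \<longrightarrow> separates A (L, M)"
proof -
  obtain U V where UV: "parcs H = U \<times> V \<union> V \<times> U"
    using assms by (auto simp: biclique_def complete_bipartite_digraph_def)
  have sub: "parcs H \<subseteq> parcs (bi_intersection_graph n k k)"
    using assms by (auto simp: biclique_def subgraph_def)
  have cross: "S \<inter> M = {}" if "(Inl S, Inr N) \<in> parcs H" "(Inl L, Inr M) \<in> parcs H" for S N L M
  proof -
    \<comment> \<open>The sides \<open>U\<close> and \<open>V\<close> are not yet matched with the
      tags. If \<open>Inl S\<close> and \<open>Inl L\<close> are on the same side, then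
      \<open>Inl S\<close> is joined to \<open>Inr M\<close>; on opposite sides they would be joined
      to each other, but no arc of the graph joins two \<open>Inl\<close> vertices.\<close>
    have "(Inl S, Inr M) \<in> parcs H \<or> (Inl L, Inl S) \<in> parcs H"
      using that UV by auto
    then show ?thesis
      using sub by (auto simp: parcs_bi_intersection_graph disjoint_pairs_def)
  qed
  let ?A = "\<Union>{S. \<exists>N. (Inl S, Inr N) \<in> parcs H}"
  have "?A \<subseteq> {1..n}"
    using sub by (fastforce simp: parcs_bi_intersection_graph disjoint_pairs_def)
  moreover have "separates ?A (L, M)" if "(Inl L, Inr M) \<in> parcs H" for L M
    using that cross by (fastforce simp: separates_def)
  ultimately show ?thesis by blast
qed

lemma binomial_le_biclique_covering:
  assumes "biclique_covering ((2 * t - 2 * k) choose (t - k)) (bi_intersection_graph (2 * t) k k) F"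
    and "k \<le> t"
  shows "(2 * t) choose t \<le> size F"
\<comment> \<open>Each edge is represented by its arc leaving the \<open>Inl\<close> side, so that
  it is a single element of \<open>disjoint_pairs\<close>.\<close>
proof (rule binomial_le_size_covering[where V = "{1..2 * t}" and k = k
      and P = "\<lambda>H (L, M). (Inl L, Inr M) \<in> parcs H"])
  fix e :: "nat set \<times> nat set"
  obtain L M where e: "e = (L, M)" by fastforce
  assume "e \<in> disjoint_pairs k {1..2 * t}"
  then have "(Inl L, Inr M) \<in> parcs (bi_intersection_graph (2 * t) k k)"
    by (simp only: e arc_bi_intersection_graph)
  then show "(2 * t - 2 * k) choose (t - k)
      \<le> size {#H \<in># F. case e of (L, M) \<Rightarrow> (Inl L, Inr M) \<in> parcs H#}"
    using assms(1) by (simp add: e biclique_covering_def)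
next
  fix H assume "H \<in># F"
  then have "biclique (bi_intersection_graph (2 * t) k k) H"
    using assms(1) by (simp add: biclique_covering_def)
  then obtain A where "A \<subseteq> {1..2 * t}" "\<forall>(L, M)\<in>disjoint_pairs k {1..2 * t}.
      (Inl L, Inr M) \<in> parcs H \<longrightarrow> separates A (L, M)"
    using biclique_separates by blast
  then show "\<exists>A\<subseteq>{1..2 * t}. \<forall>e\<in>disjoint_pairs k {1..2 * t}.
      (case e of (L, M) \<Rightarrow> (Inl L, Inr M) \<in> parcs H) \<longrightarrow> separates A e"
    by (intro exI[of _ A]) auto
qed (use assms in auto)

text \<open>For \<open>T \<subseteq> V\<close> the edges are all pairs that \<open>T\<close>
  separates, gathered into one biclique.\<close>

definition separation_biclique :: "nat \<Rightarrow> 'a set \<Rightarrow> 'a set \<Rightarrow> ('a set + 'a set) pair_pre_digraph" where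
  "separation_biclique k V T =
     (let U = Inl ` subsets_of_card k T; W = Inr ` subsets_of_card k (V - T)
      in \<lparr>pverts = U \<union> W, parcs = U \<times> W \<union> W \<times> U\<rparr>)"

lemma parcs_separation_biclique:
  assumes "(L, M) \<in> disjoint_pairs k V"
  shows "(Inl L, Inr M) \<in> parcs (separation_biclique k V T) \<longleftrightarrow> separates T (L, M)"
    and "(Inr M, Inl L) \<in> parcs (separation_biclique k V T) \<longleftrightarrow> separates T (L, M)"
proof -
  have "L \<in> subsets_of_card k T \<longleftrightarrow> L \<subseteq> T" "M \<in> subsets_of_card k (V - T) \<longleftrightarrow> M \<inter> T = {}"
    using assms unfolding subsets_of_card_def disjoint_pairs_def by blast+
  then show "(Inl L, Inr M) \<in> parcs (separation_biclique k V T) \<longleftrightarrow> separates T (L, M)"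
    and "(Inr M, Inl L) \<in> parcs (separation_biclique k V T) \<longleftrightarrow> separates T (L, M)"
    unfolding separation_biclique_def Let_def separates_def
    by (simp_all add: image_iff conj_commute)
qed

text \<open>A subset of \<open>T\<close> and a subset of its complement are disjoint, so all edges
  lie in the graph. The two bounds on \<open>k\<close> make both sides nonempty, as
  \<open>biclique\<close> requires.\<close>

lemma biclique_separation_biclique:
  assumes "T \<subseteq> {1..n}" "k \<le> card T" "k \<le> n - card T"
  shows "biclique (bi_intersection_graph n k k) (separation_biclique k {1..n} T)"
proof -
  define U where "U = (Inl ` subsets_of_card k T :: (nat set + nat set) set)"
  define W where "W = (Inr ` subsets_of_card k ({1..n} - T) :: (nat set + nat set) set)"
  let ?H = "separation_biclique k {1..n} T"
  have H: "pverts ?H = U \<union> W" "parcs ?H = U \<times> W \<union> W \<times> U"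
    by (simp_all add: separation_biclique_def U_def W_def Let_def)
  have T: "finite T" using assms(1) finite_subset by blast
  have card: "card U = card T choose k" "card W = (n - card T) choose k"
    using assms T
    by (simp_all add: U_def W_def card_image card_subsets_of_card card_Diff_subset)
  have fin: "finite U" "finite W"
    using T by (simp_all add: U_def W_def finite_subsets_of_card)
  have disj: "U \<inter> W = {}"
    by (auto simp: U_def W_def)
  have K: "complete_bipartite_digraph (card U) (card W) (with_proj ?H)"
    using H fin disj by (auto simp: complete_bipartite_digraph_pair_def)
  then have "graph (with_proj ?H)"
    by (simp add: complete_bipartite_digraph_def)
  then have "wf_digraph (with_proj ?H)"
    by (simp add: graph_def digraph_def fin_digraph_def)
  moreover have "wf_digraph (with_proj (bi_intersection_graph n k k))"
    using pair_graph_bi_intersection_graph[of n k k]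
    by (simp add: wf_digraph_wp_iff pair_graph_def pair_digraph_def pair_fin_digraph_def)
  moreover have "pverts ?H \<subseteq> pverts (bi_intersection_graph n k k)"
    using assms(1) unfolding H
    by (auto simp: U_def W_def subsets_of_card_def bi_intersection_graph_def Let_def)
  moreover have "parcs ?H \<subseteq> parcs (bi_intersection_graph n k k)"
  proof -
    have "(L, M) \<in> disjoint_pairs k {1..n}"
      if "L \<in> subsets_of_card k T" "M \<in> subsets_of_card k ({1..n} - T)" for L M
      using that assms(1) unfolding disjoint_pairs_def subsets_of_card_def by blast
    then show ?thesis
      unfolding H U_def W_def using arc_bi_intersection_graph[where n = n and k = k] by blast
  qed
  ultimately have "subgraph (with_proj ?H) (with_proj (bi_intersection_graph n k k))"
    by (auto simp: subgraph_def)
  moreover have "0 < card U" "0 < card W"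
    using assms by (simp_all add: card)
  ultimately show ?thesis
    using K unfolding biclique_def by blast
qed

text \<open>Among the bicliques of all \<open>t\<close>-subsets, an edge given by
  \<open>(L, M)\<close> lies in exactly those whose \<open>T\<close> separates the pair, and their
  number is the same for every edge.\<close>

lemma ex_biclique_partition:
  assumes "k \<le> t"
  shows "\<exists>F. biclique_partition ((2 * t - 2 * k) choose (t - k)) (bi_intersection_graph (2 * t) k k) F
    \<and> size F = (2 * t) choose t"
proof (intro exI conjI)
  let ?V = "{1..2 * t}"
  let ?T = "subsets_of_card t ?V"
  \<comment> \<open>Each \<open>T\<close> contributes one member to the multiset, so its size and
    its multiplicities are numbers of \<open>t\<close>-subsets.\<close>
  let ?F = "image_mset (separation_biclique k ?V) (mset_set ?T)"
  have fin: "finite ?T" by (simp add: finite_subsets_of_card)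
  show "size ?F = (2 * t) choose t"
    by (simp add: card_subsets_of_card)
  have "size {#H \<in># ?F. e \<in> parcs H#} = (2 * t - 2 * k) choose (t - k)"
    if e: "e \<in> parcs (bi_intersection_graph (2 * t) k k)" for e
  proof -
    obtain L M where LM: "(L, M) \<in> disjoint_pairs k ?V" "e = (Inl L, Inr M) \<or> e = (Inr M, Inl L)"
      using e by (auto simp: parcs_bi_intersection_graph)
    then have "e \<in> parcs (separation_biclique k ?V T) \<longleftrightarrow> separates T (L, M)" for T
      using parcs_separation_biclique by blast
    then have "size {#H \<in># ?F. e \<in> parcs H#} = card {T \<in> ?T. separates T (L, M)}"
      using fin by (simp add: filter_mset_image_mset)
    also have "\<dots> = (2 * t - 2 * k) choose (t - k)"
      using card_subsets_of_card_between[of ?V L M t] LM assms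
      by (auto simp: disjoint_pairs_def mult_2)
    finally show ?thesis .
  qed
  moreover have "biclique (bi_intersection_graph (2 * t) k k) (separation_biclique k ?V T)"
    if "T \<in> ?T" for T
    using that assms by (intro biclique_separation_biclique) (auto simp: subsets_of_card_def)
  ultimately show "biclique_partition ((2 * t - 2 * k) choose (t - k))
      (bi_intersection_graph (2 * t) k k) ?F"
    using fin by (auto simp: biclique_partition_def)
qed

section \<open>The three minima\<close>

lemma Inf_enat_eqI:
  assumes "P n" "\<And>m. P m \<Longrightarrow> n \<le> m"
  shows "Inf {enat m | m. P m} = enat n"
  using assms by (intro antisym Inf_lower Inf_greatest) auto

theorem theorem2p2:
  fixes k t d :: nat
  assumes "1 \<le> k" and "k \<le> t"
    and "d = (2 * t - 2 * k) choose (t - k)"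
  shows "cff_number k k d (2 * t) = biclique_covering_number d (bi_intersection_graph (2 * t) k k)
    \<and> biclique_covering_number d (bi_intersection_graph (2 * t) k k)
        = biclique_partition_number d (bi_intersection_graph (2 * t) k k)
    \<and> biclique_partition_number d (bi_intersection_graph (2 * t) k k) = enat ((2 * t) choose t)"
proof -
  let ?G = "bi_intersection_graph (2 * t) k k" and ?N = "(2 * t) choose t"
  \<comment> \<open>The lower bound for coverings thus applies to partitions too, and one partition
    of size \<open>?N\<close> attains both minima.\<close>
  have covering: "biclique_covering d ?G F" if "biclique_partition d ?G F" for F
    using that by (simp add: biclique_partition_def biclique_covering_def)
  have lower: "?N \<le> size F" if "biclique_covering d ?G F" for F
    using that binomial_le_biclique_covering assms by blast
  obtain F where F: "biclique_partition d ?G F" "size F = ?N"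
    using ex_biclique_partition assms by blast
  have "cff_number k k d (2 * t) = enat ?N"
    unfolding cff_number_def
    using ex_cover_free_family binomial_le_cover_free_family assms
    by (intro Inf_enat_eqI) blast+
  moreover have "biclique_covering_number d ?G = enat ?N"
    unfolding biclique_covering_number_def
    using F covering lower by (intro antisym Inf_lower Inf_greatest) force+
  moreover have "biclique_partition_number d ?G = enat ?N"
    unfolding biclique_partition_number_def
    using F covering lower by (intro antisym Inf_lower Inf_greatest) force+
  ultimately show ?thesis by simp
qed

end
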